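(* An indexed preorder $\mathcal{P}:\mathbf{Set}^{\mathrm{op}}\to\mathbf{Ord}$ is in the essential image of the 2-functor $\mathrm{fam}(-):\mathbf{DCO}\to\mathbf{IOrd}$ (i.e. is equivalent in $\mathbf{IOrd}$ to $\mathrm{fam}(A,\mathcal{F}_A)$ for some discrete combinatory object $(A,\mathcal{F}_A)$) if and only if it has a discrete generic predicate.
   Context: **DCOs.** Partial functions are identified with their graphs, compared by inclusion $\subseteq$ and composed as relations. A discrete combinatory object (DCO) is a pair $(A,\mathcal{F}_A)$ with $A$ a set and $\mathcal{F}_A$ a set of partial endofunctions on $A$ containing $\mathrm{id}_A$ and such that for all $\alpha,\beta\in\mathcal{F}_A$ there is $\gamma\in\mathcal{F}_A$ with $\beta\circ\alpha\subseteq\gamma$. A DCO morphism $(A,\mathcal{F}_A)\to(B,\mathcal{F}_B)$ is a function $f:A\to B$ such that for all $\alpha\in\mathcal{F}_A$ there is $\beta\in\mathcal{F}_B$ with $f\circ\alpha\subseteq\beta\circ f$; morphisms are preordered by $f\leq g$ iff there is $\beta\in\mathcal{F}_B$ with $\beta\circ f=g$. This defines the locally ordered category $\mathbf{DCO}$. **Indexed preorders.** $\mathbf{Ord}$ is the locally ordered category of preorders and monotone maps. An indexed preorder is a contravariant (pseudo)functor $\mathcal{P}:\mathbf{Set}^{\mathrm{op}}\to\mathbf{Ord}$ (split if strictly functorial); the action of a function $f:I\to J$ is written $f^*:\mathcal{P}(J)\to\mathcal{P}(I)$, and $\varphi\cong\psi$ means $\varphi\leq\psi\leq\varphi$. $\mathbf{IOrd}$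 is the locally ordered category of indexed preorders and pseudo-natural transformations (families of monotone maps commuting with reindexing up to $\cong$), ordered pointwise. An equivalence in $\mathbf{IOrd}$ is a pseudo-natural transformation all of whose components are equivalences of preorders. **Family fibration.** For a DCO $(A,\mathcal{F}_A)$, $\mathrm{fam}(A,\mathcal{F}_A)$ is the (split) indexed preorder $I\mapsto(A^I,\leq)$, where for $\varphi,\psi:I\to A$ one has $\varphi\leq\psi$ iff there is $\alpha\in\mathcal{F}_A$ with $\alpha\circ\varphi=\psi$, and reindexing is precomposition. $\mathrm{fam}$ acts on DCO morphisms by postcomposition. **Discrete and generic predicates.** Let $\mathcal{P}$ be an indexed preorder, $A$ a set, $\mu\in\mathcal{P}(A)$. $\mu$ is discrete if for any span $I\xleftarrow{e}J\xrightarrow{f}A$ of functions with $e$ surjective, and any $\varphi\in\mathcal{P}(I)$ such that $e^*\varphi\leq f^*\mu$, there is a (necessarily unique) $h:I\to A$ with $he=f$ and $\varphi\leq h^*\mu$. $\mu$ is a generic predicate if for any set $I$ and $\varphi\in\mathcal{P}(I)$ there is a (not necessarily unique) function $f:I\to A$ with $\varphi\cong f^*\mu$. A discrete generic predicate is a $\mu$ having both properties. *)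

theory Defs
  imports "HOL-Library.FuncSet"
begin

text \<open>
  The category \<open>Set\<close> is given by a class \<open>\<U>\<close> of subsets of a type \<open>'u\<close> that contains
  every subset of each of its members; all functions between members of \<open>\<U>\<close> are arrows.
  For \<open>'u\<close> a universe of sets and \<open>\<U>\<close> its small subclasses this is the category of all sets;
  \<open>\<U> = UNIV\<close> gives all subsets of \<open>'u\<close>.

  An arrow \<open>I \<rightarrow> J\<close> is an element of \<open>I \<rightarrow>\<^sub>E J\<close>, so that equality of arrows is equality in HOL;
  the identity of \<open>I\<close> is \<open>\<lambda>i\<in>I. i\<close>, and \<open>compose I g f\<close> is the composite of \<open>f\<close>, with domain \<open>I\<close>,
  followed by \<open>g\<close>.
\<close>

definition set_universe :: "'u set set \<Rightarrow> bool" where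
  "set_universe \<U> \<longleftrightarrow> (\<forall>I\<in>\<U>. \<forall>J. J \<subseteq> I \<longrightarrow> J \<in> \<U>)"


section \<open>Discrete combinatory objects\<close>

text \<open>
  Partial functions are single-valued relations. The composite written \<open>\<beta> \<circ> \<alpha>\<close> in mathematics
  (first \<open>\<alpha>\<close>) is \<open>\<alpha> O \<beta>\<close>.
\<close>

definition dco :: "'u set \<Rightarrow> ('u \<times> 'u) set set \<Rightarrow> bool" where
  "dco A F \<longleftrightarrow>
     (\<forall>\<alpha>\<in>F. \<alpha> \<subseteq> A \<times> A \<and> single_valued \<alpha>) \<and>
     Id_on A \<in> F \<and>
     (\<forall>\<alpha>\<in>F. \<forall>\<beta>\<in>F. \<exists>\<gamma>\<in>F. \<alpha> O \<beta> \<subseteq> \<gamma>)"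

definition fun_graph :: "'u set \<Rightarrow> ('u \<Rightarrow> 'v) \<Rightarrow> ('u \<times> 'v) set" where
  "fun_graph I f = (\<lambda>i. (i, f i)) ` I"


section \<open>Indexed preorders\<close>

text \<open>
  \<open>reidx P I J f\<close> is the map \<open>f\<^sup>*\<close> from \<open>fib P J\<close> to \<open>fib P I\<close> for an arrow \<open>f\<close> from \<open>I\<close> to \<open>J\<close>.
  Domain and codomain are arguments because \<open>f\<close> alone does not determine its codomain.
\<close>

record ('u, 'p) ipre =
  fib :: "'u set \<Rightarrow> 'p set"
  le :: "'u set \<Rightarrow> 'p \<Rightarrow> 'p \<Rightarrow> bool"
  reidx :: "'u set \<Rightarrow> 'u set \<Rightarrow> ('u \<Rightarrow> 'u) \<Rightarrow> 'p \<Rightarrow> 'p"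

definition fib_iso :: "('u, 'p) ipre \<Rightarrow> 'u set \<Rightarrow> 'p \<Rightarrow> 'p \<Rightarrow> bool" where
  "fib_iso P I \<phi> \<psi> \<longleftrightarrow> le P I \<phi> \<psi> \<and> le P I \<psi> \<phi>"

text \<open>
  Pseudofunctors into preorders: no coherence conditions are needed on the isomorphisms,
  as parallel 2-cells between monotone maps are equal.
\<close>

definition indexed_preorder :: "'u set set \<Rightarrow> ('u, 'p) ipre \<Rightarrow> bool" where
  "indexed_preorder \<U> P \<longleftrightarrow>
     (\<forall>I\<in>\<U>. reflp_on (fib P I) (le P I) \<and> transp_on (fib P I) (le P I)) \<and>
     (\<forall>I\<in>\<U>. \<forall>J\<in>\<U>. \<forall>f \<in> I \<rightarrow>\<^sub>E J.
        reidx P I J f \<in> fib P J \<rightarrow> fib P I \<and>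
        monotone_on (fib P J) (le P J) (le P I) (reidx P I J f)) \<and>
     (\<forall>I\<in>\<U>. \<forall>\<phi>\<in>fib P I. fib_iso P I (reidx P I I (\<lambda>i\<in>I. i) \<phi>) \<phi>) \<and>
     (\<forall>I\<in>\<U>. \<forall>J\<in>\<U>. \<forall>K\<in>\<U>. \<forall>f \<in> I \<rightarrow>\<^sub>E J. \<forall>g \<in> J \<rightarrow>\<^sub>E K. \<forall>\<phi>\<in>fib P K.
        fib_iso P I (reidx P I K (compose I g f) \<phi>) (reidx P I J f (reidx P J K g \<phi>)))"

definition pseudo_natural ::
  "'u set set \<Rightarrow> ('u, 'p) ipre \<Rightarrow> ('u, 'q) ipre \<Rightarrow> ('u set \<Rightarrow> 'p \<Rightarrow> 'q) \<Rightarrow> bool" where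
  "pseudo_natural \<U> P Q \<tau> \<longleftrightarrow>
     (\<forall>I\<in>\<U>. \<tau> I \<in> fib P I \<rightarrow> fib Q I \<and> monotone_on (fib P I) (le P I) (le Q I) (\<tau> I)) \<and>
     (\<forall>I\<in>\<U>. \<forall>J\<in>\<U>. \<forall>f \<in> I \<rightarrow>\<^sub>E J. \<forall>\<phi>\<in>fib P J.
        fib_iso Q I (\<tau> I (reidx P I J f \<phi>)) (reidx Q I J f (\<tau> J \<phi>)))"

definition preorder_equivalence ::
  "'p set \<Rightarrow> ('p \<Rightarrow> 'p \<Rightarrow> bool) \<Rightarrow> 'q set \<Rightarrow> ('q \<Rightarrow> 'q \<Rightarrow> bool) \<Rightarrow> ('p \<Rightarrow> 'q) \<Rightarrow> bool" where
  "preorder_equivalence X leX Y leY t \<longleftrightarrow>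
     t \<in> X \<rightarrow> Y \<and> monotone_on X leX leY t \<and>
     (\<exists>s \<in> Y \<rightarrow> X. monotone_on Y leY leX s \<and>
        (\<forall>x\<in>X. leX (s (t x)) x \<and> leX x (s (t x))) \<and>
        (\<forall>y\<in>Y. leY (t (s y)) y \<and> leY y (t (s y))))"

definition iord_equivalence ::
  "'u set set \<Rightarrow> ('u, 'p) ipre \<Rightarrow> ('u, 'q) ipre \<Rightarrow> ('u set \<Rightarrow> 'p \<Rightarrow> 'q) \<Rightarrow> bool" where
  "iord_equivalence \<U> P Q \<tau> \<longleftrightarrow>
     pseudo_natural \<U> P Q \<tau> \<and>
     (\<forall>I\<in>\<U>. preorder_equivalence (fib P I) (le P I) (fib Q I) (le Q I) (\<tau> I))"


section \<open>Family fibrations and their essential image\<close>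

definition fam :: "'u set \<Rightarrow> ('u \<times> 'u) set set \<Rightarrow> ('u, 'u \<Rightarrow> 'u) ipre" where
  "fam A F =
     \<lparr> fib = (\<lambda>I. I \<rightarrow>\<^sub>E A),
       le = (\<lambda>I \<phi> \<psi>. \<exists>\<alpha>\<in>F. fun_graph I \<phi> O \<alpha> = fun_graph I \<psi>),
       reidx = (\<lambda>I J f \<phi>. compose I \<phi> f) \<rparr>"

lemma fam_le_iff:
  assumes "dco A F"
  shows "le (fam A F) I \<phi> \<psi> \<longleftrightarrow> (\<exists>\<alpha>\<in>F. \<forall>i\<in>I. (\<phi> i, \<psi> i) \<in> \<alpha>)"
proof -
  have "fun_graph I \<phi> O \<alpha> = fun_graph I \<psi> \<longleftrightarrow> (\<forall>i\<in>I. (\<phi> i, \<psi> i) \<in> \<alpha>)" if "\<alpha> \<in> F" for \<alpha>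
  proof
    assume eq: "fun_graph I \<phi> O \<alpha> = fun_graph I \<psi>"
    show "\<forall>i\<in>I. (\<phi> i, \<psi> i) \<in> \<alpha>"
    proof
      fix i assume "i \<in> I"
      then have "(i, \<psi> i) \<in> fun_graph I \<phi> O \<alpha>" unfolding eq by (simp add: fun_graph_def)
      then show "(\<phi> i, \<psi> i) \<in> \<alpha>" by (auto simp: fun_graph_def)
    qed
  next
    assume "\<forall>i\<in>I. (\<phi> i, \<psi> i) \<in> \<alpha>"
    moreover have "single_valued \<alpha>" using assms that by (simp add: dco_def)
    ultimately show "fun_graph I \<phi> O \<alpha> = fun_graph I \<psi>"
      by (auto simp: fun_graph_def dest: single_valuedD)
  qed
  then show ?thesis by (simp add: fam_def)
qed

lemma indexed_preorder_fam:
  assumes "dco A F"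
  shows "indexed_preorder \<U> (fam A F)"
proof -
  have idF: "Id_on A \<in> F" using assms by (simp add: dco_def)
  have refl: "le (fam A F) I \<phi> \<phi>" if "\<phi> \<in> I \<rightarrow>\<^sub>E A" for I \<phi>
    unfolding fam_le_iff[OF assms] using idF that by (intro bexI[of _ "Id_on A"]) auto
  have trans: "le (fam A F) I \<phi> \<chi>"
    if "le (fam A F) I \<phi> \<psi>" "le (fam A F) I \<psi> \<chi>" for I \<phi> \<psi> \<chi>
  proof -
    from that obtain \<alpha> \<beta> where ab: "\<alpha> \<in> F" "\<beta> \<in> F"
      "\<forall>i\<in>I. (\<phi> i, \<psi> i) \<in> \<alpha>" "\<forall>i\<in>I. (\<psi> i, \<chi> i) \<in> \<beta>"
      unfolding fam_le_iff[OF assms] by blast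
    moreover obtain \<gamma> where "\<gamma> \<in> F" "\<alpha> O \<beta> \<subseteq> \<gamma>"
      using assms ab unfolding dco_def by meson
    ultimately show ?thesis unfolding fam_le_iff[OF assms] by blast
  qed
  have mono: "le (fam A F) I (compose I \<phi> f) (compose I \<psi> f)"
    if "f \<in> I \<rightarrow>\<^sub>E J" "le (fam A F) J \<phi> \<psi>" for I J f \<phi> \<psi>
    using that unfolding fam_le_iff[OF assms] by (auto simp: compose_def PiE_iff)
  have fib: "fib (fam A F) I = I \<rightarrow>\<^sub>E A" and rx: "reidx (fam A F) I J f \<phi> = compose I \<phi> f"
    for I J f \<phi> by (simp_all add: fam_def)
  have id: "compose I \<phi> (\<lambda>i\<in>I. i) = \<phi>" if "\<phi> \<in> I \<rightarrow>\<^sub>E A" for I :: "'a set" and \<phi>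
    using that by (auto simp: compose_def PiE_iff extensional_def)
  have comp: "compose I \<phi> (compose I g f) = compose I (compose J \<phi> g) f"
    if "f \<in> I \<rightarrow>\<^sub>E J" for I J :: "'a set" and f g :: "'a \<Rightarrow> 'a" and \<phi> :: "'a \<Rightarrow> 'a"
    using that by (auto simp: compose_def PiE_iff)
  have cl: "compose I \<phi> f \<in> I \<rightarrow>\<^sub>E A" if "f \<in> I \<rightarrow>\<^sub>E J" "\<phi> \<in> J \<rightarrow>\<^sub>E A" for I J :: "'a set" and f \<phi>
    using that by (auto simp: compose_def PiE_iff)
  show ?thesis
    unfolding indexed_preorder_def fib_iso_def fib rx
    by (intro conjI ballI reflp_onI transp_onI monotone_onI funcsetI)
       (simp_all add: id comp cl mono refl, (blast intro: trans refl cl)+)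
qed

definition in_essential_image_fam :: "'u set set \<Rightarrow> ('u, 'p) ipre \<Rightarrow> bool" where
  "in_essential_image_fam \<U> P \<longleftrightarrow>
     (\<exists>A\<in>\<U>. \<exists>F. dco A F \<and> (\<exists>\<tau>. iord_equivalence \<U> P (fam A F) \<tau>))"


section \<open>Discrete and generic predicates\<close>

definition discrete_predicate :: "'u set set \<Rightarrow> ('u, 'p) ipre \<Rightarrow> 'u set \<Rightarrow> 'p \<Rightarrow> bool" where
  "discrete_predicate \<U> P A \<mu> \<longleftrightarrow>
     (\<forall>I\<in>\<U>. \<forall>J\<in>\<U>. \<forall>e \<in> J \<rightarrow>\<^sub>E I. \<forall>f \<in> J \<rightarrow>\<^sub>E A. \<forall>\<phi>\<in>fib P I.
        e ` J = I \<longrightarrow> le P J (reidx P J I e \<phi>) (reidx P J A f \<mu>) \<longrightarrow>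
        (\<exists>h \<in> I \<rightarrow>\<^sub>E A. compose J h e = f \<and> le P I \<phi> (reidx P I A h \<mu>)))"

definition generic_predicate :: "'u set set \<Rightarrow> ('u, 'p) ipre \<Rightarrow> 'u set \<Rightarrow> 'p \<Rightarrow> bool" where
  "generic_predicate \<U> P A \<mu> \<longleftrightarrow>
     (\<forall>I\<in>\<U>. \<forall>\<phi>\<in>fib P I. \<exists>f \<in> I \<rightarrow>\<^sub>E A. fib_iso P I \<phi> (reidx P I A f \<mu>))"

definition has_discrete_generic_predicate :: "'u set set \<Rightarrow> ('u, 'p) ipre \<Rightarrow> bool" where
  "has_discrete_generic_predicate \<U> P \<longleftrightarrow>
     (\<exists>A\<in>\<U>. \<exists>\<mu>\<in>fib P A. discrete_predicate \<U> P A \<mu> \<and> generic_predicate \<U> P A \<mu>)"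

end

theory Submission
  imports Defs
begin

text \<open>
  If \<open>\<mu>\<close> is a discrete generic predicate on \<open>A\<close>, take as partial endofunctions of \<open>A\<close> the functions
  \<open>h : D \<rightarrow> A\<close> with \<open>D \<subseteq> A\<close> for which the restriction of \<open>\<mu>\<close> to \<open>D\<close> is below \<open>h\<^sup>*\<mu>\<close>. Discreteness,
  applied to the span \<open>\<phi>(I) \<leftarrow> I \<rightarrow> A\<close> given by \<open>\<phi>\<close> and \<open>\<psi>\<close>, says that \<open>\<phi>\<^sup>*\<mu> \<le> \<psi>\<^sup>*\<mu>\<close> holds iff one of
  these partial functions carries \<open>\<phi>\<close> to \<open>\<psi>\<close>. So \<open>\<phi> \<mapsto> \<phi>\<^sup>*\<mu>\<close> is an order embedding of the family
  fibration, and genericity makes it essentially surjective. Conversely the identity of \<open>A\<close> is a discrete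
  generic predicate of the family fibration, and it is transported along the equivalence.
\<close>

text \<open>For a quasi-inverse \<open>s\<close> of \<open>t\<close> there is the chain
  \<open>x\<close> \<le> \<open>s (t x)\<close> \<le> \<open>s (t y)\<close> \<le> \<open>y\<close>.
  With monotonicity this makes \<open>t\<close> an order embedding, so inequalities can be tested
  after applying an equivalence.\<close>

lemma preorder_equivalence_reflects:
  assumes "preorder_equivalence X leX Y leY t" "transp_on X leX"
    and "x \<in> X" "y \<in> X" "leY (t x) (t y)"
  shows "leX x y"
proof -
  from assms(1) obtain s where s: "s \<in> Y \<rightarrow> X" "monotone_on Y leY leX s"
    and st: "\<forall>x\<in>X. leX (s (t x)) x \<and> leX x (s (t x))" and t: "t \<in> X \<rightarrow> Y"
    unfolding preorder_equivalence_def by blast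
  have mem: "t x \<in> Y" "t y \<in> Y" "s (t x) \<in> X" "s (t y) \<in> X" using s(1) t assms(3,4) by auto
  have "leX (s (t x)) (s (t y))" using monotone_onD[OF s(2) mem(1,2) assms(5)] .
  with st assms(3,4) mem show ?thesis by (meson assms(2) transp_onD)
qed

section \<open>Calculus of fibres and reindexing up to isomorphism\<close>

locale universe_indexed_preorder =
  fixes \<U> :: "'u set set" and P :: "('u, 'p) ipre"
  assumes universe: "set_universe \<U>" and indexed: "indexed_preorder \<U> P"
begin

lemma subset_in_universe: "I \<in> \<U> \<Longrightarrow> J \<subseteq> I \<Longrightarrow> J \<in> \<U>"
  using universe unfolding set_universe_def by blast

lemma transp_le: "I \<in> \<U> \<Longrightarrow> transp_on (fib P I) (le P I)"
  using indexed unfolding indexed_preorder_def by blast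

lemma le_refl: "I \<in> \<U> \<Longrightarrow> \<phi> \<in> fib P I \<Longrightarrow> le P I \<phi> \<phi>"
  using indexed unfolding indexed_preorder_def by (meson reflp_onD)

lemma le_trans:
  "I \<in> \<U> \<Longrightarrow> \<phi> \<in> fib P I \<Longrightarrow> \<psi> \<in> fib P I \<Longrightarrow> \<chi> \<in> fib P I \<Longrightarrow>
    le P I \<phi> \<psi> \<Longrightarrow> le P I \<psi> \<chi> \<Longrightarrow> le P I \<phi> \<chi>"
  using transp_le by (meson transp_onD)

lemma reidx_in_fib:
  "I \<in> \<U> \<Longrightarrow> J \<in> \<U> \<Longrightarrow> f \<in> I \<rightarrow>\<^sub>E J \<Longrightarrow> \<phi> \<in> fib P J \<Longrightarrow> reidx P I J f \<phi> \<in> fib P I"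
  using indexed unfolding indexed_preorder_def by blast

lemma reidx_mono:
  "I \<in> \<U> \<Longrightarrow> J \<in> \<U> \<Longrightarrow> f \<in> I \<rightarrow>\<^sub>E J \<Longrightarrow> \<phi> \<in> fib P J \<Longrightarrow> \<psi> \<in> fib P J \<Longrightarrow>
    le P J \<phi> \<psi> \<Longrightarrow> le P I (reidx P I J f \<phi>) (reidx P I J f \<psi>)"
  using indexed unfolding indexed_preorder_def by (meson monotone_onD)

lemma reidx_compose:
  "I \<in> \<U> \<Longrightarrow> J \<in> \<U> \<Longrightarrow> K \<in> \<U> \<Longrightarrow> f \<in> I \<rightarrow>\<^sub>E J \<Longrightarrow> g \<in> J \<rightarrow>\<^sub>E K \<Longrightarrow> \<phi> \<in> fib P K \<Longrightarrow>
    fib_iso P I (reidx P I K (compose I g f) \<phi>) (reidx P I J f (reidx P J K g \<phi>))"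
  using indexed unfolding indexed_preorder_def by blast

lemma fib_iso_sym: "fib_iso P I \<phi> \<psi> \<Longrightarrow> fib_iso P I \<psi> \<phi>"
  unfolding fib_iso_def by blast

lemma fib_iso_trans:
  "I \<in> \<U> \<Longrightarrow> \<phi> \<in> fib P I \<Longrightarrow> \<psi> \<in> fib P I \<Longrightarrow> \<chi> \<in> fib P I \<Longrightarrow>
    fib_iso P I \<phi> \<psi> \<Longrightarrow> fib_iso P I \<psi> \<chi> \<Longrightarrow> fib_iso P I \<phi> \<chi>"
  unfolding fib_iso_def using le_trans by blast

lemma reidx_iso:
  "I \<in> \<U> \<Longrightarrow> J \<in> \<U> \<Longrightarrow> f \<in> I \<rightarrow>\<^sub>E J \<Longrightarrow> \<phi> \<in> fib P J \<Longrightarrow> \<psi> \<in> fib P J \<Longrightarrow>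
    fib_iso P J \<phi> \<psi> \<Longrightarrow> fib_iso P I (reidx P I J f \<phi>) (reidx P I J f \<psi>)"
  unfolding fib_iso_def using reidx_mono by blast

lemma le_cong_iso:
  assumes "I \<in> \<U>" "\<phi> \<in> fib P I" "\<psi> \<in> fib P I" "\<phi>' \<in> fib P I" "\<psi>' \<in> fib P I"
    and "fib_iso P I \<phi> \<phi>'" "fib_iso P I \<psi> \<psi>'"
  shows "le P I \<phi> \<psi> \<longleftrightarrow> le P I \<phi>' \<psi>'"
  using assms unfolding fib_iso_def by (meson le_trans)

end


section \<open>The discrete combinatory object of a discrete generic predicate\<close>

locale predicate_on = universe_indexed_preorder \<U> P
  for \<U> :: "'u set set" and P :: "('u, 'p) ipre" +
  fixes A :: "'u set" and \<mu> :: 'p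
  assumes A_in: "A \<in> \<U>" and mu_in: "\<mu> \<in> fib P A"
begin

abbreviation pull :: "'u set \<Rightarrow> ('u \<Rightarrow> 'u) \<Rightarrow> 'p" where
  "pull I f \<equiv> reidx P I A f \<mu>"

text \<open>The arrow \<open>\<lambda>d\<in>D. d\<close> is the inclusion of \<open>D\<close> into
  \<open>A\<close>. Carrying the domain \<open>D\<close> along makes a partial function an honest
  arrow, along which \<open>\<mu>\<close> can be reindexed.\<close>

definition tracked :: "('u \<times> 'u) set set" where
  "tracked = {fun_graph D h | D h. D \<subseteq> A \<and> h \<in> D \<rightarrow>\<^sub>E A \<and> le P D (pull D (\<lambda>d\<in>D. d)) (pull D h)}"

lemma pull_in_fib: "I \<in> \<U> \<Longrightarrow> f \<in> I \<rightarrow>\<^sub>E A \<Longrightarrow> pull I f \<in> fib P I"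
  using reidx_in_fib A_in mu_in by blast

lemma pull_compose:
  "I \<in> \<U> \<Longrightarrow> J \<in> \<U> \<Longrightarrow> f \<in> I \<rightarrow>\<^sub>E J \<Longrightarrow> g \<in> J \<rightarrow>\<^sub>E A \<Longrightarrow>
    fib_iso P I (pull I (compose I g f)) (reidx P I J f (pull J g))"
  using reidx_compose A_in mu_in by blast

lemma pull_compose_mono:
  assumes "I \<in> \<U>" "J \<in> \<U>" "f \<in> I \<rightarrow>\<^sub>E J" "g \<in> J \<rightarrow>\<^sub>E A" "h \<in> J \<rightarrow>\<^sub>E A" "le P J (pull J g) (pull J h)"
  shows "le P I (pull I (compose I g f)) (pull I (compose I h f))"
proof -
  have gf: "compose I g f \<in> I \<rightarrow>\<^sub>E A" and hf: "compose I h f \<in> I \<rightarrow>\<^sub>E A"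
    using assms(3-5) by (auto simp: compose_def PiE_iff)
  have "le P I (reidx P I J f (pull J g)) (reidx P I J f (pull J h))"
    using assms by (intro reidx_mono pull_in_fib)
  then show ?thesis
    using le_cong_iso[OF assms(1) pull_in_fib[OF assms(1) gf] pull_in_fib[OF assms(1) hf]
        reidx_in_fib[OF assms(1-3)] reidx_in_fib[OF assms(1-3)]
        pull_compose[OF assms(1-4)] pull_compose[OF assms(1-3,5)]] pull_in_fib assms(2,4,5)
    by blast
qed

text \<open>The map \<open>\<phi>\<close> lands in the domain \<open>D\<close> of
  \<open>\<alpha>\<close> and \<open>\<psi>\<close> is \<open>h\<close> after \<open>\<phi>\<close>,
  so the inequality that makes \<open>h\<close> tracked only has to be reindexed along
  \<open>\<phi>\<close>.\<close>

lemma pull_le_of_tracked: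
  assumes "I \<in> \<U>" "\<phi> \<in> I \<rightarrow>\<^sub>E A" "\<psi> \<in> I \<rightarrow>\<^sub>E A" "\<alpha> \<in> tracked" "\<forall>i\<in>I. (\<phi> i, \<psi> i) \<in> \<alpha>"
  shows "le P I (pull I \<phi>) (pull I \<psi>)"
proof -
  from assms(4) obtain D h where D: "\<alpha> = fun_graph D h" "D \<subseteq> A" "h \<in> D \<rightarrow>\<^sub>E A"
    "le P D (pull D (\<lambda>d\<in>D. d)) (pull D h)"
    unfolding tracked_def by blast
  have graph: "\<phi> i \<in> D" "\<psi> i = h (\<phi> i)" if "i \<in> I" for i
    using assms(5) that unfolding D(1) fun_graph_def by auto
  have \<phi>: "\<phi> \<in> I \<rightarrow>\<^sub>E D" using assms(2) graph(1) by (auto simp: PiE_iff)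
  have "le P I (pull I (compose I (\<lambda>d\<in>D. d) \<phi>)) (pull I (compose I h \<phi>))"
    using assms(1) subset_in_universe[OF A_in D(2)] \<phi> _ D(3,4)
    by (rule pull_compose_mono) (use D(2) in auto)
  moreover have "compose I (\<lambda>d\<in>D. d) \<phi> = \<phi>"
    using assms(2) graph(1) by (intro ext) (auto simp: compose_def PiE_iff extensional_def)
  moreover have "compose I h \<phi> = \<psi>"
    using assms(3) graph(2) by (intro ext) (auto simp: compose_def PiE_iff extensional_def)
  ultimately show ?thesis by simp
qed

text \<open>The composite of two tracked relations is itself tracked, so the inclusion demanded of a
  DCO holds as an equality.\<close>

lemma dco_tracked: "dco A tracked"
proof -
  have "\<alpha> \<subseteq> A \<times> A \<and> single_valued \<alpha>" if "\<alpha> \<in> tracked" for \<alpha>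
    using that unfolding tracked_def fun_graph_def single_valued_def by (auto simp: PiE_iff)
  moreover have "Id_on A \<in> tracked"
  proof -
    have "Id_on A = fun_graph A (\<lambda>a\<in>A. a)" by (auto simp: fun_graph_def)
    moreover have "le P A (pull A (\<lambda>a\<in>A. a)) (pull A (\<lambda>a\<in>A. a))"
      using A_in by (intro le_refl pull_in_fib) auto
    ultimately show ?thesis unfolding tracked_def by fastforce
  qed
  moreover have "\<alpha> O \<beta> \<in> tracked" if \<alpha>: "\<alpha> \<in> tracked" and \<beta>: "\<beta> \<in> tracked" for \<alpha> \<beta>
  proof -
    from \<alpha> obtain D h where D: "\<alpha> = fun_graph D h" "D \<subseteq> A" "h \<in> D \<rightarrow>\<^sub>E A"
      unfolding tracked_def by blast
    from \<beta> obtain E k where E: "\<beta> = fun_graph E k" "E \<subseteq> A" "k \<in> E \<rightarrow>\<^sub>E A"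
      unfolding tracked_def by blast
    \<comment> \<open>This is the natural domain of the composite partial function.\<close>
    define C where "C = {d \<in> D. h d \<in> E}"
    have C: "C \<subseteq> A" using D(2) unfolding C_def by auto
    note C = C subset_in_universe[OF A_in C]
    let ?i = "\<lambda>c\<in>C. c" and ?h = "restrict h C" and ?kh = "\<lambda>c\<in>C. k (h c)"
    have maps: "?i \<in> C \<rightarrow>\<^sub>E A" "?h \<in> C \<rightarrow>\<^sub>E A" "?kh \<in> C \<rightarrow>\<^sub>E A"
      using D(2,3) E(3) unfolding C_def by auto
    \<comment> \<open>On \<open>C\<close>, \<open>\<alpha>\<close> carries the inclusion to
      \<open>?h\<close> and \<open>\<beta>\<close> carries \<open>?h\<close> to \<open>?kh\<close>;
      transitivity then gives the inequality that tracks the composite.\<close>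
    have "le P C (pull C ?i) (pull C ?h)"
      using C(2) maps(1,2) \<alpha> by (rule pull_le_of_tracked) (auto simp: C_def D(1) fun_graph_def)
    moreover have "le P C (pull C ?h) (pull C ?kh)"
      using C(2) maps(2,3) \<beta> by (rule pull_le_of_tracked) (auto simp: C_def E(1) fun_graph_def)
    ultimately have "le P C (pull C ?i) (pull C ?kh)"
      using le_trans pull_in_fib C(2) maps by meson
    moreover have "\<alpha> O \<beta> = fun_graph C ?kh"
      unfolding D(1) E(1) C_def fun_graph_def by (auto simp: relcomp_unfold)
    ultimately show ?thesis unfolding tracked_def using C(1) maps(3) by blast
  qed
  ultimately show ?thesis unfolding dco_def by blast
qed

lemma pull_le_iff:
  assumes "discrete_predicate \<U> P A \<mu>" "I \<in> \<U>" "\<phi> \<in> I \<rightarrow>\<^sub>E A" "\<psi> \<in> I \<rightarrow>\<^sub>E A"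
  shows "le P I (pull I \<phi>) (pull I \<psi>) \<longleftrightarrow> le (fam A tracked) I \<phi> \<psi>"
proof
  assume "le (fam A tracked) I \<phi> \<psi>"
  then show "le P I (pull I \<phi>) (pull I \<psi>)"
    unfolding fam_le_iff[OF dco_tracked] using pull_le_of_tracked assms(2-4) by blast
next
  assume le: "le P I (pull I \<phi>) (pull I \<psi>)"
  \<comment> \<open>Factoring \<open>\<phi>\<close> through its image supplies the surjective leg of
    the span.\<close>
  define D where "D = \<phi> ` I"
  have D: "D \<subseteq> A" using assms(3) unfolding D_def by auto
  note D = D subset_in_universe[OF A_in D]
  let ?i = "\<lambda>d\<in>D. d"
  have \<phi>: "\<phi> \<in> I \<rightarrow>\<^sub>E D" using assms(3) by (auto simp: D_def PiE_iff)
  have i: "?i \<in> D \<rightarrow>\<^sub>E A" using D(1) by auto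
  have "compose I ?i \<phi> = \<phi>"
    using assms(3) by (intro ext) (auto simp: D_def compose_def PiE_iff extensional_def)
  then have iso: "fib_iso P I (pull I \<phi>) (reidx P I D \<phi> (pull D ?i))"
    using pull_compose[OF assms(2) D(2) \<phi> i] by simp
  have "le P I (reidx P I D \<phi> (pull D ?i)) (pull I \<psi>)"
    using le_cong_iso[OF assms(2) _ _ _ _ iso, of "pull I \<psi>" "pull I \<psi>"] le
      le_refl[OF assms(2)] pull_in_fib[OF assms(2)] assms(3,4)
      reidx_in_fib[OF assms(2) D(2) \<phi> pull_in_fib[OF D(2) i]]
    by (simp add: fib_iso_def)
  \<comment> \<open>Discreteness is applied to the restriction of \<open>\<mu>\<close> to
    \<open>D\<close>; the inequality it returns is exactly the one that makes the graph of
    \<open>h\<close> tracked.\<close>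
  then obtain h where h: "h \<in> D \<rightarrow>\<^sub>E A" "compose I h \<phi> = \<psi>" "le P D (pull D ?i) (pull D h)"
    using assms(1)[unfolded discrete_predicate_def, rule_format,
        OF D(2) assms(2) \<phi> assms(4) pull_in_fib[OF D(2) i]] by (auto simp: D_def)
  have "(\<phi> j, \<psi> j) \<in> fun_graph D h" if "j \<in> I" for j
    using h(2)[symmetric] that by (auto simp: D_def fun_graph_def compose_def)
  moreover have "fun_graph D h \<in> tracked" unfolding tracked_def using D(1) h by blast
  ultimately show "le (fam A tracked) I \<phi> \<psi>" unfolding fam_le_iff[OF dco_tracked] by blast
qed

text \<open>A choice of classifying maps is quasi-inverse to \<open>pull\<close>. Since
  \<open>pull\<close> preserves and reflects the order, monotonicity, naturality and the inverse
  laws for \<open>\<tau>\<close> can all be checked on predicates of \<open>P\<close>.\<close>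

lemma in_essential_image_if_discrete_generic:
  assumes disc: "discrete_predicate \<U> P A \<mu>" and gen: "generic_predicate \<U> P A \<mu>"
  shows "in_essential_image_fam \<U> P"
proof -
  let ?Q = "fam A tracked"
  have fib: "fib ?Q I = I \<rightarrow>\<^sub>E A" and rx: "reidx ?Q I J f \<phi> = compose I \<phi> f" for I J f \<phi>
    by (simp_all add: fam_def)
  \<comment> \<open>Classifying maps are chosen arbitrarily; \<open>\<tau>\<close> is therefore
    natural only up to isomorphism.\<close>
  define \<tau> where "\<tau> I \<phi> = (SOME f. f \<in> I \<rightarrow>\<^sub>E A \<and> fib_iso P I \<phi> (pull I f))" for I \<phi>
  have "\<tau> I \<phi> \<in> I \<rightarrow>\<^sub>E A \<and> fib_iso P I \<phi> (pull I (\<tau> I \<phi>))" if "I \<in> \<U>" "\<phi> \<in> fib P I" for I \<phi>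
  proof -
    have "\<exists>f. f \<in> I \<rightarrow>\<^sub>E A \<and> fib_iso P I \<phi> (pull I f)"
      using gen that unfolding generic_predicate_def by blast
    then show ?thesis unfolding \<tau>_def by (rule someI_ex)
  qed
  then have \<tau>_in: "\<tau> I \<phi> \<in> I \<rightarrow>\<^sub>E A" and \<tau>_iso: "fib_iso P I \<phi> (pull I (\<tau> I \<phi>))"
    if "I \<in> \<U>" "\<phi> \<in> fib P I" for I \<phi>
    using that by simp_all
  have iso_iff: "fib_iso ?Q I \<phi> \<psi> \<longleftrightarrow> fib_iso P I (pull I \<phi>) (pull I \<psi>)"
    if "I \<in> \<U>" "\<phi> \<in> I \<rightarrow>\<^sub>E A" "\<psi> \<in> I \<rightarrow>\<^sub>E A" for I \<phi> \<psi>
    unfolding fib_iso_def pull_le_iff[OF disc that] pull_le_iff[OF disc that(1,3,2)] ..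
  have mono: "monotone_on (fib P I) (le P I) (le ?Q I) (\<tau> I)" if I: "I \<in> \<U>" for I
  proof (rule monotone_onI)
    fix \<phi> \<psi> assume mem: "\<phi> \<in> fib P I" "\<psi> \<in> fib P I" and "le P I \<phi> \<psi>"
    then have "le P I (pull I (\<tau> I \<phi>)) (pull I (\<tau> I \<psi>))"
      using le_cong_iso[OF I mem pull_in_fib pull_in_fib \<tau>_iso \<tau>_iso] \<tau>_in I mem by blast
    then show "le ?Q I (\<tau> I \<phi>) (\<tau> I \<psi>)"
      unfolding pull_le_iff[OF disc I \<tau>_in[OF I mem(1)] \<tau>_in[OF I mem(2)]] .
  qed
  have natural: "fib_iso ?Q I (\<tau> I (reidx P I J f \<phi>)) (compose I (\<tau> J \<phi>) f)"
    if I: "I \<in> \<U>" and J: "J \<in> \<U>" and f: "f \<in> I \<rightarrow>\<^sub>E J" and \<phi>: "\<phi> \<in> fib P J" for I J f \<phi>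
  proof -
    have rf: "reidx P I J f \<phi> \<in> fib P I" using that by (rule reidx_in_fib)
    have a: "\<tau> I (reidx P I J f \<phi>) \<in> I \<rightarrow>\<^sub>E A" and b: "\<tau> J \<phi> \<in> J \<rightarrow>\<^sub>E A"
      using \<tau>_in[OF I rf] \<tau>_in[OF J \<phi>] .
    have c: "compose I (\<tau> J \<phi>) f \<in> I \<rightarrow>\<^sub>E A" using b f by (auto simp: compose_def PiE_iff)
    have d: "reidx P I J f (pull J (\<tau> J \<phi>)) \<in> fib P I"
      using reidx_in_fib[OF I J f] pull_in_fib[OF J b] by blast
    \<comment> \<open>After pulling \<open>\<mu>\<close> back, both sides of the naturality square
      are isomorphic to \<open>reidx P I J f \<phi>\<close>.\<close>
    have 1: "fib_iso P I (pull I (\<tau> I (reidx P I J f \<phi>))) (reidx P I J f \<phi>)"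
      using \<tau>_iso[OF I rf] by (rule fib_iso_sym)
    have 2: "fib_iso P I (reidx P I J f \<phi>) (reidx P I J f (pull J (\<tau> J \<phi>)))"
      using reidx_iso[OF I J f \<phi> pull_in_fib[OF J b] \<tau>_iso[OF J \<phi>]] .
    have 3: "fib_iso P I (reidx P I J f (pull J (\<tau> J \<phi>))) (pull I (compose I (\<tau> J \<phi>) f))"
      using pull_compose[OF I J f b] by (rule fib_iso_sym)
    have "fib_iso P I (pull I (\<tau> I (reidx P I J f \<phi>))) (pull I (compose I (\<tau> J \<phi>) f))"
      using fib_iso_trans[OF I pull_in_fib[OF I a] rf pull_in_fib[OF I c] 1]
        fib_iso_trans[OF I rf d pull_in_fib[OF I c] 2 3] by simp
    then show ?thesis unfolding iso_iff[OF I a c] .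
  qed
  have equiv: "preorder_equivalence (fib P I) (le P I) (fib ?Q I) (le ?Q I) (\<tau> I)"
    if I: "I \<in> \<U>" for I
    unfolding preorder_equivalence_def fib
  proof (intro conjI bexI[of _ "pull I"])
    show "\<tau> I \<in> fib P I \<rightarrow> I \<rightarrow>\<^sub>E A" using \<tau>_in[OF I] by blast
    show "monotone_on (fib P I) (le P I) (le ?Q I) (\<tau> I)" using mono I .
    show "pull I \<in> (I \<rightarrow>\<^sub>E A) \<rightarrow> fib P I" using pull_in_fib I by blast
    show "monotone_on (I \<rightarrow>\<^sub>E A) (le ?Q I) (le P I) (pull I)"
      using pull_le_iff[OF disc] I by (simp add: monotone_on_def)
    show "\<forall>\<phi>\<in>fib P I. le P I (pull I (\<tau> I \<phi>)) \<phi> \<and> le P I \<phi> (pull I (\<tau> I \<phi>))"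
      using \<tau>_iso[OF I] unfolding fib_iso_def by blast
    show "\<forall>f\<in>I \<rightarrow>\<^sub>E A. le ?Q I (\<tau> I (pull I f)) f \<and> le ?Q I f (\<tau> I (pull I f))"
    proof
      fix f assume f: "f \<in> I \<rightarrow>\<^sub>E A"
      have "fib_iso ?Q I f (\<tau> I (pull I f))"
        unfolding iso_iff[OF I f \<tau>_in[OF I pull_in_fib[OF I f]]]
        using \<tau>_iso[OF I pull_in_fib[OF I f]] .
      then show "le ?Q I (\<tau> I (pull I f)) f \<and> le ?Q I f (\<tau> I (pull I f))"
        unfolding fib_iso_def by blast
    qed
  qed
  have "pseudo_natural \<U> P ?Q \<tau>"
    unfolding pseudo_natural_def fib rx
    by (intro conjI ballI funcsetI mono natural \<tau>_in)
  then show ?thesis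
    unfolding in_essential_image_fam_def iord_equivalence_def
    using A_in dco_tracked equiv by blast
qed

end


section \<open>The discrete generic predicate of a family fibration\<close>

text \<open>The predicate sought is the one that the equivalence \<open>\<tau>\<close> sends to the
  identity of \<open>A\<close>. Then \<open>\<tau>\<close> sends its reindexing along
  \<open>f\<close> to \<open>f\<close> itself, up to isomorphism, and both properties become
  statements about maps into \<open>A\<close>.\<close>

lemma (in universe_indexed_preorder) has_discrete_generic_if_in_essential_image:
  assumes "in_essential_image_fam \<U> P"
  shows "has_discrete_generic_predicate \<U> P"
proof -
  from assms obtain A F \<tau> where A: "A \<in> \<U>" and F: "dco A F"
    and nat: "pseudo_natural \<U> P (fam A F) \<tau>"
    and equiv: "\<And>I. I \<in> \<U> \<Longrightarrow>
      preorder_equivalence (fib P I) (le P I) (fib (fam A F) I) (le (fam A F) I) (\<tau> I)"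
    unfolding in_essential_image_fam_def iord_equivalence_def by blast
  let ?Q = "fam A F"
  have fib: "fib ?Q I = I \<rightarrow>\<^sub>E A" and rx: "reidx ?Q I J f \<phi> = compose I \<phi> f" for I J f \<phi>
    by (simp_all add: fam_def)
  \<comment> \<open>This makes the calculus of reindexing available in the family fibration as
    well.\<close>
  interpret Q: universe_indexed_preorder \<U> ?Q
    using universe indexed_preorder_fam[OF F] by unfold_locales
  have \<tau>_in: "\<tau> I \<phi> \<in> I \<rightarrow>\<^sub>E A" if "I \<in> \<U>" "\<phi> \<in> fib P I" for I \<phi>
    using nat that unfolding pseudo_natural_def fib by blast
  have natural: "fib_iso ?Q I (\<tau> I (reidx P I J f \<phi>)) (compose I (\<tau> J \<phi>) f)"
    if "I \<in> \<U>" "J \<in> \<U>" "f \<in> I \<rightarrow>\<^sub>E J" "\<phi> \<in> fib P J" for I J f \<phi>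
    using nat that unfolding pseudo_natural_def rx by blast
  have le_iff: "le P I \<phi> \<psi> \<longleftrightarrow> le ?Q I (\<tau> I \<phi>) (\<tau> I \<psi>)"
    if "I \<in> \<U>" "\<phi> \<in> fib P I" "\<psi> \<in> fib P I" for I \<phi> \<psi>
    using preorder_equivalence_reflects[OF equiv transp_le] nat that
    unfolding pseudo_natural_def monotone_on_def by blast
  let ?id = "\<lambda>a\<in>A. a"
  have id: "?id \<in> A \<rightarrow>\<^sub>E A" by auto
  \<comment> \<open>Essential surjectivity of the component at \<open>A\<close> provides
    \<open>\<mu>\<close>.\<close>
  obtain \<mu> where \<mu>: "\<mu> \<in> fib P A" "fib_iso ?Q A (\<tau> A \<mu>) ?id"
    using equiv[OF A] id unfolding preorder_equivalence_def fib fib_iso_def by blast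
  have \<tau>_pull: "fib_iso ?Q I (\<tau> I (reidx P I A f \<mu>)) f" if I: "I \<in> \<U>" and f: "f \<in> I \<rightarrow>\<^sub>E A" for I f
  proof -
    have "fib_iso ?Q I (compose I (\<tau> A \<mu>) f) (compose I ?id f)"
      using Q.reidx_iso[OF I A f, of "\<tau> A \<mu>" ?id] \<mu> \<tau>_in[OF A] id unfolding fib rx by blast
    moreover have "compose I ?id f = f"
      using f by (intro ext) (auto simp: compose_def PiE_iff extensional_def)
    moreover have "compose I (\<tau> A \<mu>) f \<in> I \<rightarrow>\<^sub>E A"
      using f \<tau>_in[OF A \<mu>(1)] by (auto simp: compose_def PiE_iff)
    moreover have "\<tau> I (reidx P I A f \<mu>) \<in> I \<rightarrow>\<^sub>E A"
      using \<tau>_in reidx_in_fib I A f \<mu>(1) by blast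
    ultimately show ?thesis
      using Q.fib_iso_trans[OF I, unfolded fib] natural[OF I A f \<mu>(1)] f by metis
  qed
  have "generic_predicate \<U> P A \<mu>"
    unfolding generic_predicate_def
  proof (intro ballI)
    fix I \<phi> assume I: "I \<in> \<U>" and \<phi>: "\<phi> \<in> fib P I"
    have f: "\<tau> I \<phi> \<in> I \<rightarrow>\<^sub>E A" using \<tau>_in I \<phi> .
    \<comment> \<open>The classifying map of \<open>\<phi>\<close> is
      \<open>\<tau> I \<phi>\<close>: both predicates have isomorphic images under
      \<open>\<tau>\<close>, which reflects the order.\<close>
    have "fib_iso P I \<phi> (reidx P I A (\<tau> I \<phi>) \<mu>)"
      using \<tau>_pull[OF I f] le_iff[OF I] \<phi> reidx_in_fib[OF I A f \<mu>(1)] unfolding fib_iso_def by blast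
    then show "\<exists>f\<in>I \<rightarrow>\<^sub>E A. fib_iso P I \<phi> (reidx P I A f \<mu>)" using f by blast
  qed
  moreover have "discrete_predicate \<U> P A \<mu>"
    unfolding discrete_predicate_def
  proof (intro ballI impI)
    fix I J e f \<phi>
    assume I: "I \<in> \<U>" and J: "J \<in> \<U>" and e: "e \<in> J \<rightarrow>\<^sub>E I" and f: "f \<in> J \<rightarrow>\<^sub>E A"
      and \<phi>: "\<phi> \<in> fib P I" and surj: "e ` J = I"
      and le: "le P J (reidx P J I e \<phi>) (reidx P J A f \<mu>)"
    have re: "reidx P J I e \<phi> \<in> fib P J" and rf: "reidx P J A f \<mu> \<in> fib P J"
      using reidx_in_fib I J A e f \<phi> \<mu>(1) by auto
    have g: "\<tau> I \<phi> \<in> I \<rightarrow>\<^sub>E A" using \<tau>_in I \<phi> .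
    have ge: "compose J (\<tau> I \<phi>) e \<in> J \<rightarrow>\<^sub>E A" using g e by (auto simp: compose_def PiE_iff)
    have "le ?Q J (compose J (\<tau> I \<phi>) e) f"
      using Q.le_cong_iso[OF J, unfolded fib, OF \<tau>_in[OF J re] \<tau>_in[OF J rf] ge f
          natural[OF J I e \<phi>] \<tau>_pull[OF J f]] le_iff[OF J re rf] le by blast
    then obtain \<alpha> where \<alpha>: "\<alpha> \<in> F" and step: "\<forall>j\<in>J. (\<tau> I \<phi> (e j), f j) \<in> \<alpha>"
      unfolding fam_le_iff[OF F] by (auto simp: compose_def)
    have sv: "single_valued \<alpha>" using F \<alpha> unfolding dco_def by blast
    \<comment> \<open>The map \<open>h\<close> is \<open>\<alpha>\<close> after
      \<open>\<tau> I \<phi>\<close>. As \<open>e\<close> is surjective, every \<open>i\<close> is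
      some \<open>e j\<close>, where \<open>\<alpha>\<close> has the value \<open>f j\<close>;
      single-valuedness makes this independent of \<open>j\<close>.\<close>
    define h where "h = (\<lambda>i\<in>I. THE a. (\<tau> I \<phi> i, a) \<in> \<alpha>)"
    have he: "h (e j) = f j" if "j \<in> J" for j
    proof -
      have "(THE a. (\<tau> I \<phi> (e j), a) \<in> \<alpha>) = f j"
        using step that sv by (blast intro: the_equality dest: single_valuedD)
      then show ?thesis using that surj unfolding h_def by auto
    qed
    have h: "h \<in> I \<rightarrow>\<^sub>E A"
    proof (rule PiE_I)
      show "h i \<in> A" if "i \<in> I" for i using that surj he f by force
    qed (simp add: h_def)
    have "compose J h e = f"
      using he f by (intro ext) (auto simp: compose_def PiE_iff extensional_def)
    \<comment> \<open>The same \<open>\<alpha>\<close> that witnesses the inequality over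
      \<open>J\<close> witnesses this one over \<open>I\<close>.\<close>
    moreover have "le ?Q I (\<tau> I \<phi>) h"
    proof -
      have "(\<tau> I \<phi> i, h i) \<in> \<alpha>" if "i \<in> I" for i using that surj he step by force
      then show ?thesis unfolding fam_le_iff[OF F] using \<alpha> by blast
    qed
    then have "le P I \<phi> (reidx P I A h \<mu>)"
      using \<tau>_pull[OF I h] le_iff[OF I \<phi> reidx_in_fib[OF I A h \<mu>(1)]] g h
        Q.le_trans[OF I, unfolded fib] \<tau>_in[OF I reidx_in_fib[OF I A h \<mu>(1)]]
      unfolding fib_iso_def by blast
    ultimately show "\<exists>h\<in>I \<rightarrow>\<^sub>E A. compose J h e = f \<and> le P I \<phi> (reidx P I A h \<mu>)"
      using h by blast
  qed
  ultimately show ?thesis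
    unfolding has_discrete_generic_predicate_def using A \<mu>(1) by blast
qed

theorem proposition2p4:
  fixes \<U> :: "'u set set" and P :: "('u, 'p) ipre"
  assumes "set_universe \<U>" and "indexed_preorder \<U> P"
  shows "in_essential_image_fam \<U> P \<longleftrightarrow> has_discrete_generic_predicate \<U> P"
proof
  interpret universe_indexed_preorder \<U> P using assms by unfold_locales
  show "has_discrete_generic_predicate \<U> P" if "in_essential_image_fam \<U> P"
    using that by (rule has_discrete_generic_if_in_essential_image)
  show "in_essential_image_fam \<U> P" if "has_discrete_generic_predicate \<U> P"
  proof -
    from that obtain A \<mu> where "A \<in> \<U>" "\<mu> \<in> fib P A"
      and dg: "discrete_predicate \<U> P A \<mu>" "generic_predicate \<U> P A \<mu>"
      unfolding has_discrete_generic_predicate_def by blast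
    then interpret predicate_on \<U> P A \<mu> by unfold_locales
    show ?thesis using dg by (rule in_essential_image_if_discrete_generic)
  qed
qed

end
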